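(* Let $H(s)=C(s)K(s)^{-1}B(s)$ be the full-order model, let $\{\sigma_j\}_{j=1}^r,\{\mu_i\}_{i=1}^r\subset\mathbb{C}$ be interpolation points with tangential directions $\{b_j\}_{j=1}^r\subset\mathbb{C}^m$ and $\{c_i\}_{i=1}^r\subset\mathbb{C}^p$, and let $\widehat H_r(s)=\widehat C_r(s)\widehat K_r(s)^{-1}\widehat B_r(s)$ be the inexact reduced model built from the inexact bases $\widehat V_r,\widehat W_r$, with residuals $\eta_j,\xi_i$ (all as in the context). Then for all $i,j\in\{1,\dots,r\}$ $$\frac{\|\widehat H_r(\sigma_j)b_j-H(\sigma_j)b_j\|}{\|H(\sigma_j)b_j\|}\le \mathrm{cond}_B(H(\sigma_j)b_j)\,\frac{\sin\Theta(\mathfrak{C}_p(\sigma_j),\widehat{\mathcal W}_r)}{\cos\Theta(\widehat{\mathfrak P}_r(\sigma_j),\widehat{\mathcal W}_r)}\,\frac{\|\eta_j\|}{\|B(\sigma_j)b_j\|},$$ $$\frac{\|c_i^T\widehat H_r(\mu_i)-c_i^TH(\mu_i)\|}{\|c_i^TH(\mu_i)\|}\le \mathrm{cond}_C(c_i^TH(\mu_i))\,\frac{\sin\Theta(\mathfrak{B}_m(\mu_i),\widehat{\mathcal V}_r)}{\cos\Theta(\widehat{\mathfrak Q}_r(\mu_i),\widehat{\mathcal V}_r)}\,\frac{\|\xi_i\|}{\|c_i^TC(\mu_i)\|}.$$ Moreover, if $\mu_i=\sigma_i$ for some $i$, then for that $i$ $$|c_i^T\widehat H_r(\mu_i)b_i-c_i^TH(\mu_i)b_i|\le\frac{\|K(\mu_i)^{-1}\|\,\|\eta_i\|\,\|\xi_i\|}{\max\big(\cos\Theta(\widehat{\mathfrak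 P}_r(\mu_i),\widehat{\mathcal W}_r),\ \cos\Theta(\widehat{\mathfrak Q}_r(\mu_i),\widehat{\mathcal V}_r)\big)}$$ and $$|c_i^TH'(\mu_i)b_i-c_i^T\widehat H_r'(\mu_i)b_i|\le M\left(\frac{\|\eta_i\|}{\cos\Theta(\widehat{\mathfrak P}_r(\mu_i),\widehat{\mathcal W}_r)}+\frac{\|\xi_i\|}{\cos\Theta(\widehat{\mathfrak Q}_r(\mu_i),\widehat{\mathcal V}_r)}+\frac{\|\eta_i\|}{\cos\Theta(\widehat{\mathfrak P}_r(\mu_i),\widehat{\mathcal W}_r)}\,\frac{\|\xi_i\|}{\cos\Theta(\widehat{\mathfrak Q}_r(\mu_i),\widehat{\mathcal V}_r)}\right),$$ where $$M=\max\left(\left\|\tfrac{d}{ds}\big[c_i^TC(s)K(s)^{-1}\big]\big|_{s=\mu_i}\right\|,\ \left\|\tfrac{d}{ds}\big[K(s)^{-1}B(s)b_i\big]\big|_{s=\mu_i}\right\|,\ \left\|\tfrac{d}{ds}\big[K(s)^{-1}\big]\big|_{s=\mu_i}\right\|\right).$$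
   Context: $K(s)\in\mathbb{C}^{n\times n}$, $B(s)\in\mathbb{C}^{n\times m}$, $C(s)\in\mathbb{C}^{p\times n}$ are matrix-valued functions of $s\in\mathbb{C}$, analytic near all the points $\sigma_j,\mu_i$, with $K$ nonsingular there (e.g. $B,C,K$ analytic and $K$ of full rank in the right half plane, where the points lie). $\|\cdot\|$ is the Euclidean norm of vectors and the spectral norm of matrices; $^T$ is transpose without conjugation; orthogonal complements are taken in $\mathbb{C}^n$ with its standard Hermitian inner product. Inexact bases: $\{\widehat v_1,\dots,\widehat v_r\}$ and $\{\widehat w_1,\dots,\widehat w_r\}$ are arbitrary linearly independent sets in $\mathbb{C}^n$, thought of as approximate solutions of $K(\sigma_j)v_j=B(\sigma_j)b_j$ and $w_i^TK(\mu_i)=c_i^TC(\mu_i)$; $\widehat V_r=[\widehat v_1,\dots,\widehat v_r]$, $\widehat W_r=[\widehat w_1,\dots,\widehat w_r]$. Residuals: $$\eta_j=K(\sigma_j)\widehat v_j-B(\sigma_j)b_j,\qquad \xi_i=K(\mu_i)^T\widehat w_i-C(\mu_i)^Tc_i .$$ Reduced quantities: $\widehat K_r(s)=\widehat W_r^TK(s)\widehat V_r$, $\widehat B_r(s)=\widehat W_r^TB(s)$, $\widehat C_r(s)=C(s)\widehat V_r$. The matrices $\widehat K_r(\sigma_j)$ and $\widehat K_r(\mu_i)$ are assumed nonsingular, and the denominators $\|H(\sigma_j)b_j\|$, $\|c_i^TH(\mu_i)\|$ are assumed nonzero where they appear. Subspaces: $\widehat{\mathcal V}_r=\mathrm{Ran}\,\widehat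 V_r$, $\widehat{\mathcal W}_r=\mathrm{Ker}(\widehat W_r^T)^\perp$ (equivalently the span of the entrywise complex conjugates of the $\widehat w_i$; equal to $\mathrm{Ran}\,\widehat W_r$ when that space is closed under conjugation), $\widehat{\mathfrak P}_r(s)=\mathrm{Ran}(K(s)\widehat V_r)$, $\widehat{\mathfrak Q}_r(s)=\mathrm{Ker}(\widehat W_r^TK(s))^\perp$, $\mathfrak B_m(s)=\mathrm{Ran}(K(s)^{-1}B(s))$, $\mathfrak C_p(s)=\mathrm{Ker}(C(s)K(s)^{-1})^\perp$. Angle: for subspaces $\mathcal M,\mathcal N$ of $\mathbb{C}^n$, $\Theta(\mathcal M,\mathcal N)\in[0,\pi/2]$ is defined by $\sin\Theta(\mathcal M,\mathcal N)=\sup_{0\ne x\in\mathcal M}\inf_{y\in\mathcal N}\|y-x\|/\|x\|$. Condition numbers: $$\mathrm{cond}_B(H(\sigma)b)=\frac{\|C(\sigma)K(\sigma)^{-1}\|\,\|B(\sigma)b\|}{\|H(\sigma)b\|},\qquad \mathrm{cond}_C(c^TH(\mu))=\frac{\|c^TC(\mu)\|\,\|K(\mu)^{-1}B(\mu)\|}{\|c^TH(\mu)\|}.$$ *)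

theory Defs
  imports "HOL-Complex_Analysis.Complex_Analysis"
begin

text \<open>The library norm on matrices is the Frobenius norm; the spectral norm is the operator
  norm with respect to the Euclidean norms, which are the library norms on vectors.\<close>

definition spectral_norm :: "complex^'m^'n \<Rightarrow> real" where
  "spectral_norm A = onorm (\<lambda>x. A *v x)"

definition columns_matrix :: "('r \<Rightarrow> complex^'n) \<Rightarrow> complex^'r^'n" where
  "columns_matrix v = (\<chi> a j. v j $ a)"

definition mat_ran :: "complex^'m^'n \<Rightarrow> (complex^'n) set" where
  "mat_ran A = range (\<lambda>x. A *v x)"

definition mat_ker :: "complex^'m^'n \<Rightarrow> (complex^'m) set" where
  "mat_ker A = {x. A *v x = 0}"

text \<open>The library inner product on complex vectors is real valued, so the Hermitian one is
  defined here. By contrast, \<^const>\<open>scalar_product\<close> is the bilinear pairing without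
  conjugation.\<close>

definition hermitian_inner :: "complex^'n \<Rightarrow> complex^'n \<Rightarrow> complex" where
  "hermitian_inner x y = (\<Sum>k\<in>UNIV. cnj (x $ k) * y $ k)"

definition hermitian_comp :: "(complex^'n) set \<Rightarrow> (complex^'n) set" where
  "hermitian_comp S = {x. \<forall>y\<in>S. hermitian_inner y x = 0}"

text \<open>The supremum over the nonzero vectors of the zero subspace is read as 0.\<close>

definition subspace_gap :: "(complex^'n) set \<Rightarrow> (complex^'n) set \<Rightarrow> real" where
  "subspace_gap M N =
     (if M \<subseteq> {0} then 0 else (SUP x\<in>M - {0}. INF y\<in>N. norm (y - x) / norm x))"

definition subspace_angle :: "(complex^'n) set \<Rightarrow> (complex^'n) set \<Rightarrow> real" where
  "subspace_angle M N = arcsin (subspace_gap M N)"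

lemma subspace_gap_bounds:
  fixes M N :: "(complex^'n) set"
  assumes "0 \<in> N"
  shows "0 \<le> subspace_gap M N" "subspace_gap M N \<le> 1"
proof -
  define g where "g = (\<lambda>x::complex^'n. INF y\<in>N. norm (y - x) / norm x)"
  have bdd: "bdd_below ((\<lambda>y. norm (y - x) / norm x) ` N)" for x
    by (intro bdd_belowI2[of _ 0]) auto
  have g0: "0 \<le> g x" for x
    unfolding g_def using assms by (intro cINF_greatest) auto
  have g1: "g x \<le> 1" if "x \<noteq> 0" for x
    unfolding g_def using cINF_lower[OF bdd[of x] assms] that by simp
  have "0 \<le> subspace_gap M N \<and> subspace_gap M N \<le> 1"
  proof (cases "M \<subseteq> {0}")
    case False
    then obtain x where x: "x \<in> M - {0}" by blast
    have bda: "bdd_above (g ` (M - {0}))"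
      by (intro bdd_aboveI2[of _ _ 1]) (auto simp: g1)
    have "0 \<le> Sup (g ` (M - {0}))"
      using cSUP_upper[OF x bda] g0[of x] by linarith
    moreover have "Sup (g ` (M - {0})) \<le> 1"
      using x by (intro cSUP_least) (auto simp: g1)
    ultimately show ?thesis
      using False by (simp add: subspace_gap_def g_def)
  qed (simp add: subspace_gap_def)
  then show "0 \<le> subspace_gap M N" "subspace_gap M N \<le> 1" by auto
qed

lemma subspace_angle:
  assumes "0 \<in> N"
  shows "subspace_angle M N \<in> {0..pi/2}" "sin (subspace_angle M N) = subspace_gap M N"
proof -
  note b = subspace_gap_bounds[OF assms, of M]
  show "sin (subspace_angle M N) = subspace_gap M N"
    using b by (simp add: subspace_angle_def)
  have "arcsin 0 \<le> arcsin (subspace_gap M N)"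
    using b by (intro arcsin_le_arcsin) auto
  moreover have "arcsin (subspace_gap M N) \<le> pi / 2"
    using b by (intro arcsin_ubound) auto
  ultimately show "subspace_angle M N \<in> {0..pi/2}"
    by (simp add: subspace_angle_def)
qed

definition mat_analytic_on :: "(complex \<Rightarrow> complex^'m^'n) \<Rightarrow> complex set \<Rightarrow> bool" where
  "mat_analytic_on F S \<longleftrightarrow> (\<forall>a k. (\<lambda>s. F s $ a $ k) analytic_on S)"

text \<open>The library derivative \<^const>\<open>deriv\<close> is for scalar functions; it is applied to each entry.\<close>

definition vec_deriv :: "(complex \<Rightarrow> complex^'n) \<Rightarrow> complex \<Rightarrow> complex^'n" where
  "vec_deriv f z = (\<chi> k. deriv (\<lambda>s. f s $ k) z)"

definition mat_deriv :: "(complex \<Rightarrow> complex^'m^'n) \<Rightarrow> complex \<Rightarrow> complex^'m^'n" where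
  "mat_deriv F z = (\<chi> a k. deriv (\<lambda>s. F s $ a $ k) z)"

definition transfer ::
  "(complex \<Rightarrow> complex^'n^'n) \<Rightarrow> (complex \<Rightarrow> complex^'m^'n) \<Rightarrow> (complex \<Rightarrow> complex^'n^'p)
    \<Rightarrow> complex \<Rightarrow> complex^'m^'p" where
  "transfer K B C s = C s ** matrix_inv (K s) ** B s"

definition reduced_K ::
  "complex^'r^'n \<Rightarrow> complex^'r^'n \<Rightarrow> (complex \<Rightarrow> complex^'n^'n) \<Rightarrow> complex \<Rightarrow> complex^'r^'r" where
  "reduced_K V W K s = transpose W ** K s ** V"

definition reduced_B ::
  "complex^'r^'n \<Rightarrow> (complex \<Rightarrow> complex^'m^'n) \<Rightarrow> complex \<Rightarrow> complex^'m^'r" where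
  "reduced_B W B s = transpose W ** B s"

definition reduced_C ::
  "complex^'r^'n \<Rightarrow> (complex \<Rightarrow> complex^'n^'p) \<Rightarrow> complex \<Rightarrow> complex^'r^'p" where
  "reduced_C V C s = C s ** V"

definition reduced_transfer ::
  "complex^'r^'n \<Rightarrow> complex^'r^'n \<Rightarrow> (complex \<Rightarrow> complex^'n^'n) \<Rightarrow> (complex \<Rightarrow> complex^'m^'n)
    \<Rightarrow> (complex \<Rightarrow> complex^'n^'p) \<Rightarrow> complex \<Rightarrow> complex^'m^'p" where
  "reduced_transfer V W K B C =
     transfer (reduced_K V W K) (reduced_B W B) (reduced_C V C)"

definition residual_B ::
  "(complex \<Rightarrow> complex^'n^'n) \<Rightarrow> (complex \<Rightarrow> complex^'m^'n) \<Rightarrow> complex \<Rightarrow> complex^'m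
    \<Rightarrow> complex^'n \<Rightarrow> complex^'n" where
  "residual_B K B s b v = K s *v v - B s *v b"

definition residual_C ::
  "(complex \<Rightarrow> complex^'n^'n) \<Rightarrow> (complex \<Rightarrow> complex^'n^'p) \<Rightarrow> complex \<Rightarrow> complex^'p
    \<Rightarrow> complex^'n \<Rightarrow> complex^'n" where
  "residual_C K C s c w = transpose (K s) *v w - transpose (C s) *v c"

definition space_V :: "complex^'r^'n \<Rightarrow> (complex^'n) set" where
  "space_V V = mat_ran V"

text \<open>Since \<^const>\<open>transpose\<close> does not conjugate while the complement is Hermitian, this is
  the span of the entrywise conjugates of the columns of \<open>W\<close>, not their span.\<close>

definition space_W :: "complex^'r^'n \<Rightarrow> (complex^'n) set" where
  "space_W W = hermitian_comp (mat_ker (transpose W))"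

definition space_P ::
  "(complex \<Rightarrow> complex^'n^'n) \<Rightarrow> complex^'r^'n \<Rightarrow> complex \<Rightarrow> (complex^'n) set" where
  "space_P K V s = mat_ran (K s ** V)"

definition space_Q ::
  "(complex \<Rightarrow> complex^'n^'n) \<Rightarrow> complex^'r^'n \<Rightarrow> complex \<Rightarrow> (complex^'n) set" where
  "space_Q K W s = hermitian_comp (mat_ker (transpose W ** K s))"

definition space_B ::
  "(complex \<Rightarrow> complex^'n^'n) \<Rightarrow> (complex \<Rightarrow> complex^'m^'n) \<Rightarrow> complex \<Rightarrow> (complex^'n) set" where
  "space_B K B s = mat_ran (matrix_inv (K s) ** B s)"

definition space_C ::
  "(complex \<Rightarrow> complex^'n^'n) \<Rightarrow> (complex \<Rightarrow> complex^'n^'p) \<Rightarrow> complex \<Rightarrow> (complex^'n) set" where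
  "space_C K C s = hermitian_comp (mat_ker (C s ** matrix_inv (K s)))"

definition cond_B ::
  "(complex \<Rightarrow> complex^'n^'n) \<Rightarrow> (complex \<Rightarrow> complex^'m^'n) \<Rightarrow> (complex \<Rightarrow> complex^'n^'p)
    \<Rightarrow> complex \<Rightarrow> complex^'m \<Rightarrow> real" where
  "cond_B K B C s b =
     spectral_norm (C s ** matrix_inv (K s)) * norm (B s *v b) / norm (transfer K B C s *v b)"

definition cond_C ::
  "(complex \<Rightarrow> complex^'n^'n) \<Rightarrow> (complex \<Rightarrow> complex^'m^'n) \<Rightarrow> (complex \<Rightarrow> complex^'n^'p)
    \<Rightarrow> complex \<Rightarrow> complex^'p \<Rightarrow> real" where
  "cond_C K B C s c =
     norm (c v* C s) * spectral_norm (matrix_inv (K s) ** B s) / norm (c v* transfer K B C s)"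

definition deriv_const ::
  "(complex \<Rightarrow> complex^'n^'n) \<Rightarrow> (complex \<Rightarrow> complex^'m^'n) \<Rightarrow> (complex \<Rightarrow> complex^'n^'p)
    \<Rightarrow> complex \<Rightarrow> complex^'m \<Rightarrow> complex^'p \<Rightarrow> real" where
  "deriv_const K B C z b c =
     Max {norm (vec_deriv (\<lambda>s. c v* (C s ** matrix_inv (K s))) z),
          norm (vec_deriv (\<lambda>s. (matrix_inv (K s) ** B s) *v b) z),
          spectral_norm (mat_deriv (\<lambda>s. matrix_inv (K s)) z)}"

end

theory Submission
  imports Defs
begin

text \<open>Write \<open>X = K\<inverse>\<close> and \<open>G = V K\<^sub>r\<inverse> W\<^sup>T\<close>, so that the error \<open>H\<^sub>r - H\<close> is \<open>C (G - X) B\<close>. The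
  matrices \<open>P = K G\<close> and \<open>Q = G K\<close> are oblique projections with \<open>(1 - P) K v = 0\<close> for \<open>v\<close> in the trial
  space and \<open>w\<^sup>T K (1 - Q) = 0\<close> for \<open>w\<close> in the test space. Hence the error applied to \<open>b\<close> is
  \<open>C X (1 - P) \<eta>\<close>, and the error tested with \<open>c\<close> is \<open>\<xi>\<^sup>T (1 - Q) X B\<close>. If both hold at the same point, the
  bilinear error is \<open>- \<xi>\<^sup>T X (1 - P) \<eta> = - \<xi>\<^sup>T (1 - Q) X \<eta>\<close>. Differentiating
  \<open>c\<^sup>T (H - H\<^sub>r) b = x\<^sup>T (K - K G K) y\<close> with \<open>x\<^sup>T = c\<^sup>T C X\<close> and \<open>y = X B b\<close> gives
  \<open>- x'\<^sup>T (1 - P) \<eta> - \<xi>\<^sup>T (1 - Q) y' - \<xi>\<^sup>T (1 - Q) X' (1 - P) \<eta>\<close>.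

  All norm estimates rest on one fact: if \<open>p \<in> M\<close> and \<open>u\<close> is orthogonal to \<open>N\<close>, then
  \<open>\<bar>p \<bullet> u\<bar> \<le> sin \<Theta>(M, N) \<parallel>p\<parallel> \<parallel>u\<parallel>\<close>. It bounds \<open>\<parallel>u\<parallel> cos \<Theta>(M, N)\<close> by \<open>\<parallel>p + u\<parallel>\<close>, in particular
  \<open>\<parallel>(1 - P) \<eta>\<parallel>\<close> by \<open>\<parallel>\<eta>\<parallel> / cos \<Theta>\<close>.\<close>

unbundle no fps_syntax

section \<open>Angles between subspaces\<close>

lemma subspace_gap_ge:
  assumes "0 \<in> N" "x \<in> M" "x \<noteq> 0"
  shows "(INF y\<in>N. norm (y - x) / norm x) \<le> subspace_gap M N"
proof -
  \<comment> \<open>The choice \<open>y = 0\<close> bounds every infimum by 1, so the supremum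
    defining the gap runs over a set bounded above.\<close>
  have "(INF y\<in>N. norm (y - z) / norm z) \<le> 1" if "z \<noteq> 0" for z
  proof -
    have "bdd_below ((\<lambda>y. norm (y - z) / norm z) ` N)"
      by (intro bdd_belowI2[of _ 0]) auto
    from cINF_lower[OF this assms(1)] that show ?thesis by simp
  qed
  then have "bdd_above ((\<lambda>z. INF y\<in>N. norm (y - z) / norm z) ` (M - {0}))"
    by (intro bdd_aboveI2[of _ _ 1]) auto
  from cSUP_upper[OF _ this, of x] assms show ?thesis
    by (auto simp: subspace_gap_def)
qed

text \<open>Subtracting any \<open>y \<in> N\<close> from \<open>p\<close> leaves the product with
  \<open>u\<close> unchanged, so Cauchy-Schwarz bounds it by the distance from \<open>p\<close> to
  \<open>N\<close> times the norm of \<open>u\<close>.\<close>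

lemma abs_inner_le_subspace_gap:
  assumes "0 \<in> N" "p \<in> M" "u \<in> N\<^sup>\<bottom>"
  shows "\<bar>p \<bullet> u\<bar> \<le> subspace_gap M N * norm p * norm u"
proof (cases "p = 0 \<or> u = 0")
  case False
  have "\<bar>p \<bullet> u\<bar> / (norm p * norm u) \<le> norm (y - p) / norm p" if "y \<in> N" for y
  proof -
    have "y \<bullet> u = 0"
      using assms(3) that by (auto simp: orthogonal_comp_def orthogonal_def)
    then have "\<bar>p \<bullet> u\<bar> = \<bar>(y - p) \<bullet> u\<bar>"
      by (simp add: inner_diff_left)
    also have "\<dots> \<le> norm (y - p) * norm u"
      by (rule Cauchy_Schwarz_ineq2)
    finally show ?thesis
      using False by (simp add: field_simps)
  qed
  then have "\<bar>p \<bullet> u\<bar> / (norm p * norm u) \<le> (INF y\<in>N. norm (y - p) / norm p)"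
    using assms(1) by (intro cINF_greatest) auto
  also have "\<dots> \<le> subspace_gap M N"
    using assms False by (intro subspace_gap_ge) auto
  finally show ?thesis
    using False by (simp add: field_simps)
qed auto

lemma cos_subspace_angle:
  assumes "0 \<in> N"
  shows "cos (subspace_angle M N) = sqrt (1 - (subspace_gap M N)\<^sup>2)"
  using subspace_gap_bounds[OF assms, of M] by (simp add: subspace_angle_def cos_arcsin)

lemma norm_mult_cos_le_norm_add:
  assumes "0 \<in> N" "p \<in> M" "u \<in> N\<^sup>\<bottom>"
  shows "norm u * cos (subspace_angle M N) \<le> norm (p + u)"
proof (rule power2_le_imp_le)
  let ?g = "subspace_gap M N"
  have "?g\<^sup>2 \<le> 1"
    using subspace_gap_bounds[OF assms(1), of M] by (simp add: power_le_one)
  then have "(norm u * cos (subspace_angle M N))\<^sup>2 = (norm u)\<^sup>2 * (1 - ?g\<^sup>2)"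
    by (simp add: cos_subspace_angle[OF assms(1)] power_mult_distrib)
  \<comment> \<open>This completes the square: with \<open>norm p\<close> free,
    \<open>?g * norm u\<close> is the minimiser of the quadratic below, and its minimum is the left
    side.\<close>
  also have "\<dots> \<le> (norm p - ?g * norm u)\<^sup>2 + (norm u)\<^sup>2 * (1 - ?g\<^sup>2)"
    by simp
  also have "\<dots> = (norm p)\<^sup>2 + (norm u)\<^sup>2 - 2 * (?g * norm p * norm u)"
    by (simp add: power2_eq_square algebra_simps)
  also have "\<dots> \<le> (norm p)\<^sup>2 + (norm u)\<^sup>2 + 2 * (p \<bullet> u)"
    using abs_inner_le_subspace_gap[OF assms] by linarith
  also have "\<dots> = (norm (p + u))\<^sup>2"
    by (simp add: power2_norm_eq_inner inner_add_left inner_add_right inner_commute)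
  finally show "(norm u * cos (subspace_angle M N))\<^sup>2 \<le> (norm (p + u))\<^sup>2" .
qed simp

lemma orthogonal_comp_decomp:
  fixes N :: "'a::euclidean_space set"
  assumes "subspace N"
  obtains y z where "y \<in> N" "z \<in> N\<^sup>\<bottom>" "x = y + z"
  using subspace_sum_orthogonal_comp[OF assms] by (metis UNIV_I set_plus_elim)

text \<open>If \<open>P\<close> is a projection with kernel \<open>N\<^sup>\<bottom>\<close> and range containing \<open>M\<close>, then \<open>P\<close> maps the component
  of \<open>x \<in> M\<close> in \<open>N\<close> back to \<open>x\<close>, so this component cannot be much shorter than \<open>x\<close>.\<close>

lemma cos_subspace_angle_pos:
  fixes M N :: "(complex^'n) set"
  assumes "subspace N" "bounded_linear P"
    and P1: "\<And>x. x \<in> M \<Longrightarrow> P x = x" and P0: "\<And>x. x \<in> N\<^sup>\<bottom> \<Longrightarrow> P x = 0"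
  shows "0 < cos (subspace_angle M N)"
proof -
  have N0: "0 \<in> N" using assms(1) by (rule subspace_0)
  \<comment> \<open>The summand 1 gives \<open>k \<ge> 1\<close> even if \<open>P\<close> is a
    contraction, so \<open>1 - 1 / k\<^sup>2\<close> is nonnegative.\<close>
  define k where "k = onorm P + 1"
  have k: "1 \<le> k" using onorm_pos_le[OF assms(2)] by (simp add: k_def)
  \<comment> \<open>For \<open>x = y + z\<close> the projection gives
    \<open>norm x \<le> k * norm y\<close>; Pythagoras then leaves at most the fraction
    \<open>q < 1\<close> of the length of \<open>x\<close> to \<open>z\<close>, uniformly in
    \<open>x\<close>.\<close>
  define q where "q = sqrt (1 - 1 / k\<^sup>2)"
  have q: "0 \<le> q" "q < 1" using k by (auto simp: q_def)
  have "(INF y\<in>N. norm (y - x) / norm x) \<le> q" if x: "x \<in> M" "x \<noteq> 0" for x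
  proof -
    obtain y z where yz: "y \<in> N" "z \<in> N\<^sup>\<bottom>" "x = y + z"
      using orthogonal_comp_decomp[OF assms(1)] .
    have "P x = P y"
      using linear_add[OF bounded_linear.linear[OF assms(2)]] P0[OF yz(2)] yz(3) by simp
    then have "norm x \<le> onorm P * norm y"
      using onorm[OF assms(2), of y] P1[OF x(1)] by simp
    also have "\<dots> \<le> k * norm y"
      by (simp add: k_def mult_right_mono)
    finally have "(norm x)\<^sup>2 \<le> k\<^sup>2 * (norm y)\<^sup>2"
      using power_mono[of "norm x" "k * norm y" 2] by (simp add: power_mult_distrib)
    moreover have "(norm x)\<^sup>2 = (norm y)\<^sup>2 + (norm z)\<^sup>2"
    proof -
      have "y \<bullet> z = 0"
        using yz by (auto simp: orthogonal_comp_def orthogonal_def)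
      then show ?thesis
        unfolding yz(3) by (simp add: power2_norm_eq_inner inner_add_left inner_add_right inner_commute)
    qed
    ultimately have "(norm z)\<^sup>2 \<le> (1 - 1 / k\<^sup>2) * (norm x)\<^sup>2"
      using k by (simp add: field_simps)
    then have "norm z \<le> q * norm x"
      unfolding q_def using real_le_rsqrt by (fastforce simp: real_sqrt_mult)
    then have "norm (y - x) / norm x \<le> q"
      using x(2) yz(3) by (simp add: field_simps)
    moreover have "bdd_below ((\<lambda>y. norm (y - x) / norm x) ` N)"
      by (intro bdd_belowI2[of _ 0]) auto
    ultimately show ?thesis
      using cINF_lower[OF _ yz(1)] order_trans by blast
  qed
  \<comment> \<open>If \<open>M\<close> has no nonzero vector, the gap has its default value 0, and
    \<open>0 \<le> q\<close> applies.\<close>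
  then have "subspace_gap M N \<le> q"
    using q by (auto simp: subspace_gap_def intro!: cSUP_least)
  then have "(subspace_gap M N)\<^sup>2 < 1"
    using q subspace_gap_bounds[OF N0, of M] by (simp add: power_less_one_iff abs_square_less_1)
  then show ?thesis
    by (simp add: cos_subspace_angle[OF N0])
qed

section \<open>The bilinear pairing and the spectral norm\<close>

text \<open>Conjugating the left factor of the bilinear pairing makes it an argument of the real
  inner product, in which the angle estimates are stated.\<close>

definition vec_cnj :: "complex^'n \<Rightarrow> complex^'n" where
  "vec_cnj x = (\<chi> k. cnj (x $ k))"

lemma norm_vec_cnj [simp]: "norm (vec_cnj x) = norm x"
  by (simp add: vec_cnj_def norm_vec_def)

lemma vec_cnj_diff: "vec_cnj (x - y) = vec_cnj x - vec_cnj y"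
  by (simp add: vec_cnj_def vec_eq_iff)

lemma Re_scalar_product: "Re (scalar_product x y) = vec_cnj x \<bullet> y"
  by (simp add: scalar_product_def vec_cnj_def inner_vec_def inner_complex_def)

lemma inner_eq_Re_hermitian_inner: "x \<bullet> y = Re (hermitian_inner x y)"
  by (simp add: hermitian_inner_def inner_vec_def inner_complex_def)

lemma scalar_product_matrix_vector:
  "scalar_product x (A *v y) = scalar_product (x v* A) (y :: 'a::comm_ring_1^'n)"
  unfolding scalar_product_def matrix_vector_mult_def vector_matrix_mult_def
  by (simp add: sum_distrib_left sum_distrib_right mult_ac) (rule sum.swap)

lemma scalar_product_diff_left:
  "scalar_product (x - y) z = scalar_product x z - scalar_product y (z :: 'a::comm_ring_1^'n)"
  by (simp add: scalar_product_def left_diff_distrib sum_subtractf)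

lemma scalar_product_diff_right:
  "scalar_product x (y - z) = scalar_product x y - scalar_product x (z :: 'a::comm_ring_1^'n)"
  by (simp add: scalar_product_def right_diff_distrib sum_subtractf)

lemma scalar_product_add_right:
  "scalar_product x (y + z) = scalar_product x y + scalar_product x (z :: 'a::comm_ring_1^'n)"
  by (simp add: scalar_product_def distrib_left sum.distrib)

lemma scalar_product_add_left:
  "scalar_product (x + y) z = scalar_product x z + scalar_product y (z :: 'a::comm_ring_1^'n)"
  by (simp add: scalar_product_def distrib_right sum.distrib)

lemma scalar_product_minus_right:
  "scalar_product x (- y) = - scalar_product x (y :: 'a::comm_ring_1^'n)"
  by (simp add: scalar_product_def sum_negf)

text \<open>Cauchy-Schwarz for the modulus of the complex pairing, whereas
  \<open>Re_scalar_product\<close> only reaches its real part.\<close>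

lemma norm_scalar_product_le: "norm (scalar_product x y) \<le> norm x * norm (y :: complex^'n)"
proof -
  have "norm (scalar_product x y) \<le> (\<Sum>k\<in>UNIV. \<bar>norm (x $ k)\<bar> * \<bar>norm (y $ k)\<bar>)"
    unfolding scalar_product_def by (rule order_trans[OF norm_sum]) (simp add: norm_mult)
  also have "\<dots> \<le> norm x * norm y"
    unfolding norm_vec_def by (rule L2_set_mult_ineq)
  finally show ?thesis .
qed

lemma norm_matrix_vector_le: "norm (A *v x) \<le> spectral_norm A * norm x"
  unfolding spectral_norm_def by (intro onorm) simp

lemma spectral_norm_nonneg: "0 \<le> spectral_norm A"
  unfolding spectral_norm_def by (intro onorm_pos_le) simp

section \<open>Orthogonal complements and matrix bounds sharpened by the gap\<close>

text \<open>On complex subspaces the Hermitian complement is the real orthogonal complement, so real inner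
  products suffice throughout.\<close>

lemma hermitian_comp_eq_orthogonal_comp:
  assumes "\<And>x. x \<in> S \<Longrightarrow> \<i> *s x \<in> S"
  shows "hermitian_comp S = S\<^sup>\<bottom>"
proof -
  \<comment> \<open>Multiplication by \<open>\<i>\<close> turns the imaginary part into a real inner
    product with another vector of \<open>S\<close>.\<close>
  have im: "Im (hermitian_inner y x) = (\<i> *s y) \<bullet> x" for x y
    by (simp add: hermitian_inner_def inner_vec_def inner_complex_def)
  show ?thesis
    unfolding hermitian_comp_def orthogonal_comp_def orthogonal_def
    using assms by (auto simp: complex_eq_iff im simp flip: inner_eq_Re_hermitian_inner)
qed

lemma hermitian_comp_mat_ker: "hermitian_comp (mat_ker A) = (mat_ker A)\<^sup>\<bottom>"
  by (rule hermitian_comp_eq_orthogonal_comp) (simp add: mat_ker_def vector_scalar_commute)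

lemma subspace_mat_ker: "subspace (mat_ker A)"
  unfolding mat_ker_def using linear_subspace_kernel[OF matrix_vector_mul_linear] .

lemma subspace_mat_ran: "subspace (mat_ran A)"
  unfolding mat_ran_def using linear_subspace_image[OF matrix_vector_mul_linear subspace_UNIV] .

text \<open>Only the component \<open>m\<close> of \<open>u\<close> orthogonal to the kernel of
  \<open>A\<close> matters. Its squared norm is \<open>m \<bullet> u\<close>, which the gap controls
  because \<open>u\<close> is orthogonal to \<open>N\<close>.\<close>

lemma norm_matrix_vector_le_gap:
  assumes "0 \<in> N" "u \<in> N\<^sup>\<bottom>"
  shows "norm (A *v u) \<le> spectral_norm A * subspace_gap (hermitian_comp (mat_ker A)) N * norm u"
proof -
  let ?M = "hermitian_comp (mat_ker A)"
  obtain k m where km: "k \<in> mat_ker A" "m \<in> ?M" "u = k + m"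
    using orthogonal_comp_decomp[OF subspace_mat_ker] unfolding hermitian_comp_mat_ker .
  have "k \<bullet> m = 0"
    using km by (auto simp: hermitian_comp_mat_ker orthogonal_comp_def orthogonal_def)
  then have "(norm m)\<^sup>2 = m \<bullet> u"
    unfolding km(3) by (simp add: power2_norm_eq_inner inner_add_right inner_commute)
  also have "\<dots> \<le> norm m * (subspace_gap ?M N * norm u)"
    using abs_inner_le_subspace_gap[OF assms(1) km(2) assms(2)] by (simp add: mult_ac)
  finally have m: "norm m \<le> subspace_gap ?M N * norm u"
    using subspace_gap_bounds[OF assms(1), of ?M]
    by (cases "m = 0") (auto simp: power2_eq_square)
  have "A *v u = A *v m"
    using km by (simp add: mat_ker_def matrix_vector_right_distrib)
  then have "norm (A *v u) \<le> spectral_norm A * norm m"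
    using norm_matrix_vector_le by metis
  also have "\<dots> \<le> spectral_norm A * (subspace_gap ?M N * norm u)"
    by (intro mult_left_mono m spectral_norm_nonneg)
  finally show ?thesis by (simp add: mult_ac)
qed

text \<open>Pairing \<open>u v* A\<close> with its own conjugate \<open>z\<close> gives its squared
  norm. Moving \<open>A\<close> to the other side pairs \<open>u\<close> with \<open>A *v z\<close>,
  a vector of the range, where the gap applies.\<close>

lemma norm_vector_matrix_le_gap:
  assumes "0 \<in> N" "vec_cnj u \<in> N\<^sup>\<bottom>"
  shows "norm (u v* A) \<le> spectral_norm A * subspace_gap (mat_ran A) N * norm u"
proof -
  define z where "z = vec_cnj (u v* A)"
  have "(norm z)\<^sup>2 = Re (scalar_product (u v* A) z)"
    unfolding Re_scalar_product z_def power2_norm_eq_inner ..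
  also have "\<dots> = vec_cnj u \<bullet> (A *v z)"
    by (simp add: Re_scalar_product flip: scalar_product_matrix_vector)
  also have "\<dots> \<le> \<bar>(A *v z) \<bullet> vec_cnj u\<bar>"
    by (simp add: inner_commute)
  also have "\<dots> \<le> subspace_gap (mat_ran A) N * norm (A *v z) * norm u"
    using abs_inner_le_subspace_gap[OF assms(1) _ assms(2), of "A *v z" "mat_ran A"]
    by (simp add: mat_ran_def)
  also have "\<dots> \<le> subspace_gap (mat_ran A) N * (spectral_norm A * norm z) * norm u"
    by (intro mult_right_mono mult_left_mono norm_matrix_vector_le subspace_gap_bounds assms) auto
  finally have "norm z * norm z \<le> norm z * (spectral_norm A * subspace_gap (mat_ran A) N * norm u)"
    by (simp add: power2_eq_square mult_ac)
  then have "norm z \<le> spectral_norm A * subspace_gap (mat_ran A) N * norm u"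
    using subspace_gap_bounds[OF assms(1), of "mat_ran A"] spectral_norm_nonneg[of A]
    by (cases "z = 0") auto
  then show ?thesis by (simp add: z_def)
qed

section \<open>Petrov--Galerkin projections\<close>

lemma matrix_diff_rdistrib: "(A - B) ** C = A ** C - B ** (C :: 'a::ring_1^'k^'n)"
  by (simp add: matrix_matrix_mult_def vec_eq_iff left_diff_distrib sum_subtractf)

lemma matrix_add_rdistrib: "(A + B) ** C = A ** C + B ** (C :: 'a::ring_1^'k^'n)"
  by (simp add: matrix_matrix_mult_def vec_eq_iff distrib_right sum.distrib)

lemma matrix_mult_minus_right: "A ** (- B) = - (A ** (B :: 'a::ring_1^'k^'n))"
  by (simp add: matrix_matrix_mult_def vec_eq_iff sum_negf)

lemma matrix_mult_minus_left: "(- A) ** B = - (A ** (B :: 'a::ring_1^'k^'n))"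
  by (simp add: matrix_matrix_mult_def vec_eq_iff sum_negf)

lemma matrix_vector_mult_minus_left: "(- A) *v x = - (A *v (x :: 'a::ring_1^'n))"
  by (simp add: matrix_vector_mult_def vec_eq_iff sum_negf)

lemma matrix_inv_mult:
  assumes "invertible A"
  shows "A ** matrix_inv A = mat 1" "matrix_inv A ** A = mat 1"
  using assms someI_ex[of "\<lambda>B. A ** B = mat 1 \<and> B ** A = mat 1"]
  unfolding invertible_def matrix_inv_def by auto

text \<open>All data are frozen at one point \<open>s\<close>, so \<open>K\<close> is the matrix
  \<open>K(s)\<close> and the error analysis becomes linear algebra.\<close>

locale petrov_galerkin =
  fixes K :: "complex^'n^'n" and V W :: "complex^'r^'n"
  assumes invertible_K: "invertible K"
    and invertible_reduced: "invertible (transpose W ** K ** V)"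
begin

definition G :: "complex^'n^'n" where
  "G = V ** matrix_inv (transpose W ** K ** V) ** transpose W"

text \<open>\<open>res_P\<close> is \<open>1 - P\<close> acting on columns; \<open>res_Q\<close> is
  \<open>1 - Q\<close> acting on rows.\<close>

definition res_P :: "complex^'n \<Rightarrow> complex^'n" where
  "res_P x = x - K *v (G *v x)"

definition res_Q :: "complex^'n \<Rightarrow> complex^'n" where
  "res_Q x = x - (x v* G) v* K"

lemma G_K_V: "G ** K ** V = V"
proof -
  let ?A = "transpose W ** K ** V"
  have "G ** K ** V = V ** (matrix_inv ?A ** ?A)"
    by (simp add: G_def matrix_mul_assoc)
  then show ?thesis
    by (simp only: matrix_inv_mult(2)[OF invertible_reduced] matrix_mul_rid)
qed

lemma W_K_G: "transpose W ** K ** G = transpose W"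
proof -
  let ?A = "transpose W ** K ** V"
  have "transpose W ** K ** G = (?A ** matrix_inv ?A) ** transpose W"
    by (simp add: G_def matrix_mul_assoc)
  then show ?thesis
    by (simp only: matrix_inv_mult(1)[OF invertible_reduced] matrix_mul_lid)
qed

lemma G_K_on_range: "x \<in> mat_ran V \<Longrightarrow> G *v (K *v x) = x"
  unfolding mat_ran_def using G_K_V by (auto simp: matrix_vector_mul_assoc)

lemma range_W_K_G:
  assumes "x \<in> mat_ran W"
  shows "(x v* K) v* G = x"
proof -
  obtain z where "x = z v* transpose W"
    using assms by (auto simp: mat_ran_def)
  then show ?thesis
    by (simp only: vector_matrix_mul_assoc W_K_G)
qed

text \<open>By \<open>W_K_G\<close>, the test space annihilates \<open>1 - P\<close>. Since this
  kernel is the orthogonal complement of \<open>space_W W\<close>, the angle estimates apply to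
  \<open>res_P x\<close>.\<close>

lemma res_P_in_ker: "res_P x \<in> mat_ker (transpose W)"
proof -
  have "transpose W *v res_P x = transpose W *v x - (transpose W ** K ** G) *v x"
    unfolding res_P_def matrix_vector_mult_diff_distrib matrix_vector_mul_assoc
    by (simp only: matrix_mul_assoc)
  then show ?thesis
    by (simp add: W_K_G mat_ker_def)
qed

lemma res_Q_V: "res_Q x v* V = 0"
proof -
  have "res_Q x v* V = x v* V - x v* (G ** K ** V)"
    unfolding res_Q_def vector_matrix_mult_diff_distrib vector_matrix_mul_assoc
    by (simp only: matrix_mul_assoc)
  then show ?thesis
    by (simp add: G_K_V)
qed

lemma scalar_product_range_W_res_P:
  assumes "y \<in> mat_ran W"
  shows "scalar_product y (res_P x) = 0"
proof -
  obtain z where "y = z v* transpose W"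
    using assms by (auto simp: mat_ran_def)
  then have "scalar_product y (res_P x) = scalar_product z (transpose W *v res_P x)"
    by (simp only: scalar_product_matrix_vector)
  also have "\<dots> = 0"
    using res_P_in_ker[of x] unfolding mat_ker_def by (simp add: scalar_product_def)
  finally show ?thesis .
qed

lemma scalar_product_res_Q_range_V:
  assumes "y \<in> mat_ran V"
  shows "scalar_product (res_Q x) y = 0"
proof -
  obtain z where "y = V *v z"
    using assms by (auto simp: mat_ran_def)
  then show ?thesis
    by (simp add: scalar_product_matrix_vector res_Q_V) (simp add: scalar_product_def)
qed

lemma subspace_space_W: "subspace (space_W W)"
  unfolding space_W_def hermitian_comp_mat_ker by (rule subspace_orthogonal_comp)

lemma orthogonal_comp_space_W: "(space_W W)\<^sup>\<bottom> = mat_ker (transpose W)"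
  unfolding space_W_def hermitian_comp_mat_ker by (rule orthogonal_comp_self[OF subspace_mat_ker])

lemma subspace_space_V: "subspace (space_V V)"
  unfolding space_V_def by (rule subspace_mat_ran)

text \<open>\<open>res_Q x\<close> annihilates the trial space bilinearly; orthogonality therefore
  holds for its conjugate.\<close>

lemma cnj_res_Q_orthogonal: "vec_cnj (res_Q x) \<in> (space_V V)\<^sup>\<bottom>"
proof -
  have "vec_cnj (res_Q x) \<bullet> y = 0" if "y \<in> mat_ran V" for y
    using scalar_product_res_Q_range_V[OF that, of x]
    by (simp flip: Re_scalar_product)
  then show ?thesis
    by (simp add: space_V_def orthogonal_comp_def orthogonal_def inner_commute)
qed

section \<open>Cosines of the angles and norms of the complementary projections\<close>

abbreviation cos_P :: real where
  "cos_P \<equiv> cos (subspace_angle (mat_ran (K ** V)) (space_W W))"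

abbreviation cos_Q :: real where
  "cos_Q \<equiv> cos (subspace_angle (hermitian_comp (mat_ker (transpose W ** K))) (space_V V))"

text \<open>\<open>K ** G\<close> fixes the range of \<open>K ** V\<close> and vanishes on the
  complement of \<open>space_W W\<close>, so it is the projection that
  \<open>cos_subspace_angle_pos\<close> asks for.\<close>

lemma cos_P_pos: "0 < cos_P"
proof (rule cos_subspace_angle_pos[OF subspace_space_W])
  show "bounded_linear ((*v) (K ** G))" by simp
  show "(K ** G) *v x = x" if x: "x \<in> mat_ran (K ** V)" for x
  proof -
    obtain z where "x = (K ** V) *v z"
      using x by (auto simp: mat_ran_def)
    moreover have "K ** G ** (K ** V) = K ** V"
      by (metis G_K_V matrix_mul_assoc)
    ultimately show ?thesis
      by (simp only: matrix_vector_mul_assoc)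
  qed
  show "(K ** G) *v x = 0" if "x \<in> (space_W W)\<^sup>\<bottom>" for x
    using that unfolding orthogonal_comp_space_W
    by (simp add: mat_ker_def G_def del: transpose_matrix_vector flip: matrix_vector_mul_assoc)
qed

text \<open>In \<open>x = K *v (G *v x) + res_P x\<close> the first summand lies in the range of
  \<open>K ** V\<close> and the second is orthogonal to \<open>space_W W\<close>.\<close>

lemma norm_res_P: "norm (res_P x) \<le> norm x / cos_P"
proof -
  have "K *v (G *v x) \<in> mat_ran (K ** V)"
    unfolding G_def mat_ran_def by (auto simp flip: matrix_vector_mul_assoc)
  from norm_mult_cos_le_norm_add[OF subspace_0[OF subspace_space_W] this, of "res_P x"]
  show ?thesis
    using res_P_in_ker cos_P_pos by (simp add: orthogonal_comp_space_W field_simps) (simp add: res_P_def)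
qed

text \<open>\<open>G ** K\<close> factors through \<open>transpose W ** K\<close> and hence vanishes
  on its kernel, so its rows pair to zero with that kernel.\<close>

lemma cnj_G_K_in_space_Q: "vec_cnj ((x v* G) v* K) \<in> hermitian_comp (mat_ker (transpose W ** K))"
proof -
  have "vec_cnj ((x v* G) v* K) \<bullet> y = 0" if "y \<in> mat_ker (transpose W ** K)" for y
  proof -
    have "(G ** K) *v y = (V ** matrix_inv (transpose W ** K ** V)) *v ((transpose W ** K) *v y)"
      unfolding matrix_vector_mul_assoc G_def by (simp add: matrix_mul_assoc)
    also have "\<dots> = 0"
      using that by (simp add: mat_ker_def)
    finally have "scalar_product x ((G ** K) *v y) = 0"
      by (simp add: scalar_product_def)
    then show ?thesis
      by (simp add: scalar_product_matrix_vector vector_matrix_mul_assoc flip: Re_scalar_product)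
  qed
  then show ?thesis
    by (simp add: hermitian_comp_mat_ker orthogonal_comp_def orthogonal_def inner_commute)
qed

lemma norm_res_Q_mult_cos: "norm (res_Q x) * cos_Q \<le> norm x"
proof -
  have "vec_cnj ((x v* G) v* K) + vec_cnj (res_Q x) = vec_cnj x"
    by (simp add: res_Q_def vec_cnj_diff)
  then show ?thesis
    using norm_mult_cos_le_norm_add[OF subspace_0[OF subspace_space_V] cnj_G_K_in_space_Q
        cnj_res_Q_orthogonal, of x x] by simp
qed

text \<open>Here the projection is the real adjoint of \<open>G ** K\<close>: it fixes the
  complement of the kernel because \<open>y - (G ** K) *v y\<close> lies in that kernel, and it
  kills the complement of the trial space because \<open>G ** K\<close> maps into the trial
  space.\<close>

lemma cos_Q_pos: "0 < cos_Q"
proof (rule cos_subspace_angle_pos[OF subspace_space_V])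
  let ?A = "(*v) (G ** K)"
  have lin: "linear ?A" by (rule matrix_vector_mul_linear)
  show "bounded_linear (adjoint ?A)"
    using adjoint_linear[OF lin] by (rule linear_conv_bounded_linear[THEN iffD1])
  show "adjoint ?A x = x" if x: "x \<in> hermitian_comp (mat_ker (transpose W ** K))" for x
  proof (rule vector_eq_ldot[THEN iffD1], intro allI)
    fix y
    have "(transpose W ** K) *v (y - (G ** K) *v y)
        = (transpose W ** K) *v y - (transpose W ** K ** G ** K) *v y"
      unfolding matrix_vector_mult_diff_distrib matrix_vector_mul_assoc
      by (simp add: matrix_mul_assoc)
    then have "y - (G ** K) *v y \<in> mat_ker (transpose W ** K)"
      by (simp add: mat_ker_def W_K_G)
    then have "(y - (G ** K) *v y) \<bullet> x = 0"
      using x by (simp add: hermitian_comp_mat_ker orthogonal_comp_def orthogonal_def)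
    then show "y \<bullet> adjoint ?A x = y \<bullet> x"
      by (simp add: adjoint_works[OF lin] inner_diff_left)
  qed
  show "adjoint ?A x = 0" if x: "x \<in> (space_V V)\<^sup>\<bottom>" for x
  proof (rule vector_eq_ldot[THEN iffD1], intro allI)
    fix y
    have "(G ** K) *v y \<in> space_V V"
      unfolding G_def space_V_def mat_ran_def by (auto simp flip: matrix_vector_mul_assoc)
    then show "y \<bullet> adjoint ?A x = y \<bullet> 0"
      using x by (simp add: adjoint_works[OF lin] orthogonal_comp_def orthogonal_def)
  qed
qed

lemma norm_res_Q: "norm (res_Q x) \<le> norm x / cos_Q"
  using norm_res_Q_mult_cos[of x] cos_Q_pos by (simp add: field_simps)

section \<open>Error identities in terms of the residuals\<close>

lemma inv_K_mult: "matrix_inv K *v (K *v x) = x" "(x v* K) v* matrix_inv K = x"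
    "K *v (matrix_inv K *v x) = x"
  by (simp_all add: matrix_vector_mul_assoc vector_matrix_mul_assoc matrix_inv_mult[OF invertible_K])

lemma error_right:
  assumes "v \<in> mat_ran V"
  shows "G *v x - matrix_inv K *v x = matrix_inv K *v res_P (K *v v - x)"
  using G_K_on_range[OF assms]
  by (simp add: res_P_def matrix_vector_mult_diff_distrib inv_K_mult)

lemma error_left:
  assumes "w \<in> mat_ran W"
  shows "y v* G - y v* matrix_inv K = res_Q (w v* K - y) v* matrix_inv K"
  using range_W_K_G[OF assms]
  by (simp add: res_Q_def vector_matrix_mult_diff_distrib inv_K_mult)

text \<open>Each one-sided identity is tested from the other side, where the exact part
  \<open>w v* K\<close> or \<open>K *v v\<close> drops out by the annihilation property. The two
  forms carry different projections, which yields both cosines in the maximum.\<close>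

lemma error_two_sided:
  fixes v w x y :: "complex^'n"
  assumes "v \<in> mat_ran V" "w \<in> mat_ran W"
  defines "\<eta> \<equiv> K *v v - x" and "\<xi> \<equiv> w v* K - y"
  shows "scalar_product y (G *v x) - scalar_product y (matrix_inv K *v x)
       = - scalar_product \<xi> (matrix_inv K *v res_P \<eta>)"
    and "scalar_product y (G *v x) - scalar_product y (matrix_inv K *v x)
       = - scalar_product (res_Q \<xi>) (matrix_inv K *v \<eta>)"
proof -
  have "scalar_product y (G *v x) - scalar_product y (matrix_inv K *v x)
      = scalar_product (w v* K - \<xi>) (matrix_inv K *v res_P \<eta>)"
    using error_right[OF assms(1), of x] by (simp add: \<eta>_def \<xi>_def flip: scalar_product_diff_right)
  then show "scalar_product y (G *v x) - scalar_product y (matrix_inv K *v x)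
       = - scalar_product \<xi> (matrix_inv K *v res_P \<eta>)"
    using scalar_product_range_W_res_P[OF assms(2)]
    by (simp add: scalar_product_diff_left inv_K_mult flip: scalar_product_matrix_vector)
  have "scalar_product y (G *v x) - scalar_product y (matrix_inv K *v x)
      = scalar_product (res_Q \<xi>) (matrix_inv K *v (K *v v - \<eta>))"
    using error_left[OF assms(2), of y]
    by (simp add: \<eta>_def \<xi>_def scalar_product_matrix_vector flip: scalar_product_diff_left)
  then show "scalar_product y (G *v x) - scalar_product y (matrix_inv K *v x)
       = - scalar_product (res_Q \<xi>) (matrix_inv K *v \<eta>)"
    using scalar_product_res_Q_range_V[OF assms(1)]
    by (simp add: scalar_product_diff_right matrix_vector_mult_diff_distrib inv_K_mult)
qed

section \<open>Error bounds at a fixed point\<close>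

lemma norm_error_right:
  assumes "v \<in> mat_ran V"
  shows "norm ((C ** G ** B) *v b - (C ** matrix_inv K ** B) *v b)
    \<le> spectral_norm (C ** matrix_inv K)
       * (subspace_gap (hermitian_comp (mat_ker (C ** matrix_inv K))) (space_W W) / cos_P)
       * norm (K *v v - B *v b)"
proof -
  let ?A = "C ** matrix_inv K" and ?\<eta> = "K *v v - B *v b"
  let ?g = "subspace_gap (hermitian_comp (mat_ker ?A)) (space_W W)"
  note W0 = subspace_0[OF subspace_space_W]
  have "(C ** G ** B) *v b - (?A ** B) *v b = ?A *v res_P ?\<eta>"
    using error_right[OF assms, of "B *v b"]
    by (simp flip: matrix_vector_mul_assoc matrix_vector_mult_diff_distrib)
  then have "norm ((C ** G ** B) *v b - (?A ** B) *v b) \<le> spectral_norm ?A * ?g * norm (res_P ?\<eta>)"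
    using norm_matrix_vector_le_gap[OF W0, of "res_P ?\<eta>" ?A] res_P_in_ker
    by (simp add: orthogonal_comp_space_W)
  also have "\<dots> \<le> spectral_norm ?A * ?g * (norm ?\<eta> / cos_P)"
    by (intro mult_left_mono norm_res_P mult_nonneg_nonneg spectral_norm_nonneg
        subspace_gap_bounds W0)
  finally show ?thesis by simp
qed

lemma norm_error_left:
  assumes "w \<in> mat_ran W"
  shows "norm (c v* (C ** G ** B) - c v* (C ** matrix_inv K ** B))
    \<le> spectral_norm (matrix_inv K ** B)
       * (subspace_gap (mat_ran (matrix_inv K ** B)) (space_V V) / cos_Q)
       * norm (w v* K - c v* C)"
proof -
  let ?A = "matrix_inv K ** B" and ?\<xi> = "w v* K - c v* C"
  let ?g = "subspace_gap (mat_ran ?A) (space_V V)"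
  note V0 = subspace_0[OF subspace_space_V]
  have "c v* (C ** G ** B) - c v* (C ** matrix_inv K ** B) = res_Q ?\<xi> v* ?A"
    using error_left[OF assms, of "c v* C"]
    by (simp flip: vector_matrix_mul_assoc vector_matrix_mult_diff_distrib)
  then have "norm (c v* (C ** G ** B) - c v* (C ** matrix_inv K ** B))
      \<le> spectral_norm ?A * ?g * norm (res_Q ?\<xi>)"
    using norm_vector_matrix_le_gap[OF V0 cnj_res_Q_orthogonal, of ?\<xi> ?A] by simp
  also have "\<dots> \<le> spectral_norm ?A * ?g * (norm ?\<xi> / cos_Q)"
    by (intro mult_left_mono norm_res_Q mult_nonneg_nonneg spectral_norm_nonneg
        subspace_gap_bounds V0)
  finally show ?thesis by simp
qed

lemma norm_error_two_sided:
  assumes "v \<in> mat_ran V" "w \<in> mat_ran W"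
  shows "norm (scalar_product c ((C ** G ** B) *v b)
            - scalar_product c ((C ** matrix_inv K ** B) *v b))
    \<le> spectral_norm (matrix_inv K) * norm (K *v v - B *v b) * norm (w v* K - c v* C)
       / max cos_P cos_Q"
proof -
  let ?\<eta> = "K *v v - B *v b" and ?\<xi> = "w v* K - c v* C" and ?X = "matrix_inv K"
  let ?e = "norm (scalar_product c ((C ** G ** B) *v b) - scalar_product c ((C ** ?X ** B) *v b))"
  have bound: "norm (scalar_product x (?X *v y)) \<le> norm x * (spectral_norm ?X * norm y)" for x y
    by (rule order_trans[OF norm_scalar_product_le mult_left_mono[OF norm_matrix_vector_le]]) simp
  have eq: "scalar_product c ((C ** G ** B) *v b) - scalar_product c ((C ** ?X ** B) *v b)
      = scalar_product (c v* C) (G *v (B *v b)) - scalar_product (c v* C) (?X *v (B *v b))"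
    by (simp add: scalar_product_matrix_vector vector_matrix_mul_assoc)
  have "?e \<le> norm ?\<xi> * (spectral_norm ?X * norm (res_P ?\<eta>))"
    unfolding eq error_two_sided(1)[OF assms] norm_minus_cancel by (rule bound)
  also have "\<dots> \<le> norm ?\<xi> * (spectral_norm ?X * (norm ?\<eta> / cos_P))"
    by (intro mult_left_mono norm_res_P spectral_norm_nonneg norm_ge_zero)
  finally have P: "?e \<le> spectral_norm ?X * norm ?\<eta> * norm ?\<xi> / cos_P"
    by (simp add: mult_ac)
  have "?e \<le> norm (res_Q ?\<xi>) * (spectral_norm ?X * norm ?\<eta>)"
    unfolding eq error_two_sided(2)[OF assms] norm_minus_cancel by (rule bound)
  also have "\<dots> \<le> (norm ?\<xi> / cos_Q) * (spectral_norm ?X * norm ?\<eta>)"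
    by (intro mult_right_mono norm_res_Q mult_nonneg_nonneg spectral_norm_nonneg norm_ge_zero)
  finally have "?e \<le> spectral_norm ?X * norm ?\<eta> * norm ?\<xi> / cos_Q"
    by (simp add: mult_ac)
  with P show ?thesis by (simp add: max_def)
qed

text \<open>Pure algebra, with \<open>x'\<close>, \<open>y'\<close>, \<open>K'\<close> standing for
  the derivatives of \<open>B b\<close>, \<open>c\<^sup>T C\<close> and \<open>K\<close>. Replacing
  \<open>G\<close> by \<open>X\<close> plus its error cancels the terms free of \<open>p\<close> and
  \<open>u\<close>; one term linear in each and one mixed term remain.\<close>

lemma derivative_error:
  fixes v w x x' y y' :: "complex^'n" and K' :: "complex^'n^'n"
  assumes "v \<in> mat_ran V" "w \<in> mat_ran W"
  defines "X \<equiv> matrix_inv K" and "p \<equiv> res_P (K *v v - x)" and "u \<equiv> res_Q (w v* K - y)"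
  shows "(scalar_product y' (X *v x) - scalar_product (y v* X) (K' *v (X *v x))
            + scalar_product (y v* X) x')
       - (scalar_product y' (G *v x) - scalar_product (y v* G) (K' *v (G *v x))
            + scalar_product (y v* G) x')
       = - scalar_product (y' v* X - ((y v* X) v* K') v* X) p
         - scalar_product u (X *v x' - X *v (K' *v (X *v x)))
         + scalar_product u (X *v (K' *v (X *v p)))"
proof -
  have x: "G *v x = X *v x + X *v p"
    using error_right[OF assms(1), of x] by (simp add: X_def p_def algebra_simps)
  have y: "y v* G = y v* X + u v* X"
    using error_left[OF assms(2), of y] by (simp add: X_def u_def algebra_simps)
  show ?thesis
    unfolding x y
    by (simp add: matrix_vector_right_distrib vector_matrix_left_distrib scalar_product_add_right scalar_product_add_left
        scalar_product_diff_left scalar_product_diff_right scalar_product_matrix_vector)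
qed

end

section \<open>Derivatives of matrix-valued functions\<close>

text \<open>Unlike \<open>mat_deriv\<close>, this relation asserts differentiability, as the product
  rule requires.\<close>

definition has_mat_deriv ::
  "(complex \<Rightarrow> complex^'m^'n) \<Rightarrow> complex^'m^'n \<Rightarrow> complex \<Rightarrow> bool" where
  "has_mat_deriv F D z \<longleftrightarrow>
     (\<forall>a k. ((\<lambda>s. F s $ a $ k) has_field_derivative D $ a $ k) (at z))"

lemma has_mat_deriv_imp_mat_deriv: "has_mat_deriv F D z \<Longrightarrow> mat_deriv F z = D"
  by (simp add: has_mat_deriv_def mat_deriv_def vec_eq_iff DERIV_imp_deriv)

lemma has_mat_deriv_unique: "has_mat_deriv F D z \<Longrightarrow> has_mat_deriv F E z \<Longrightarrow> D = E"
  using has_mat_deriv_imp_mat_deriv by metis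

lemma mat_analytic_imp_has_mat_deriv:
  assumes "mat_analytic_on F S" "z \<in> S"
  shows "has_mat_deriv F (mat_deriv F z) z"
  unfolding has_mat_deriv_def mat_deriv_def vec_lambda_beta DERIV_deriv_iff_field_differentiable
  using assms by (auto simp: mat_analytic_on_def intro: analytic_on_imp_differentiable_at)

lemma has_mat_deriv_const: "has_mat_deriv (\<lambda>s. A) 0 z"
  by (simp add: has_mat_deriv_def)

lemma has_mat_deriv_cong_ev:
  assumes "eventually (\<lambda>s. F s = F' s) (nhds z)"
  shows "has_mat_deriv F D z \<longleftrightarrow> has_mat_deriv F' D z"
  unfolding has_mat_deriv_def
  by (intro all_cong1 DERIV_cong_ev refl eventually_mono[OF assms]) simp

lemma has_mat_deriv_mult:
  assumes "has_mat_deriv A A' z" "has_mat_deriv B B' z"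
  shows "has_mat_deriv (\<lambda>s. A s ** B s) (A' ** B z + A z ** B') z"
  using assms unfolding has_mat_deriv_def matrix_matrix_mult_def
  by (auto intro!: derivative_eq_intros simp: sum.distrib add.commute mult.commute)

lemma has_mat_deriv_mult_const_left:
  "has_mat_deriv B D z \<Longrightarrow> has_mat_deriv (\<lambda>s. A ** B s) (A ** D) z"
  using has_mat_deriv_mult[OF has_mat_deriv_const] by fastforce

lemma has_mat_deriv_mult_const_right:
  "has_mat_deriv A D z \<Longrightarrow> has_mat_deriv (\<lambda>s. A s ** B) (D ** B) z"
  using has_mat_deriv_mult[OF _ has_mat_deriv_const] by fastforce

lemma vec_deriv_vector_matrix:
  assumes "has_mat_deriv F D z"
  shows "vec_deriv (\<lambda>s. c v* F s) z = c v* D"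
proof -
  have "((\<lambda>s. \<Sum>a\<in>UNIV. c $ a * F s $ a $ k) has_field_derivative (\<Sum>a\<in>UNIV. c $ a * D $ a $ k)) (at z)" for k
    using assms unfolding has_mat_deriv_def by (auto intro!: derivative_eq_intros simp: mult.commute)
  then show ?thesis
    by (simp add: vec_deriv_def vector_matrix_mult_def vec_eq_iff DERIV_imp_deriv)
qed

lemma vec_deriv_matrix_vector:
  assumes "has_mat_deriv F D z"
  shows "vec_deriv (\<lambda>s. F s *v b) z = D *v b"
proof -
  have "((\<lambda>s. \<Sum>k\<in>UNIV. F s $ a $ k * b $ k) has_field_derivative (\<Sum>k\<in>UNIV. D $ a $ k * b $ k)) (at z)" for a
    using assms unfolding has_mat_deriv_def by (auto intro!: derivative_eq_intros)
  then show ?thesis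
    by (simp add: vec_deriv_def matrix_vector_mult_def vec_eq_iff DERIV_imp_deriv)
qed

section \<open>Analyticity and derivative of the matrix inverse\<close>

lemma det_analytic_on:
  fixes A :: "complex \<Rightarrow> complex^'n^'n"
  assumes "mat_analytic_on A S"
  shows "(\<lambda>s. det (A s)) analytic_on S"
  using assms unfolding det_def mat_analytic_on_def by (intro analytic_intros) auto

lemma matrix_vector_mult_axis: "A *v axis k 1 = column k (A :: 'a::semiring_1^'m^'n)"
  by (simp add: matrix_vector_mult_def column_def axis_def vec_eq_iff if_distrib cong: if_cong)

text \<open>Column \<open>k\<close> of the inverse solves \<open>A x = e\<close> for the
  \<open>k\<close>-th unit vector, so Cramer's rule gives its entries as quotients of
  determinants.\<close>

lemma matrix_inv_entry:
  fixes A :: "'a::field^'n^'n"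
  assumes "det A \<noteq> 0"
  shows "matrix_inv A $ i $ k =
    det (\<chi> a j. if j = i then axis k 1 $ a else A $ a $ j) / det A"
proof -
  have "A *v (matrix_inv A *v axis k 1) = axis k 1"
    using assms by (simp add: matrix_vector_mul_assoc matrix_inv_mult invertible_det_nz)
  then have "matrix_inv A *v axis k 1
      = (\<chi> i. det (\<chi> a j. if j = i then axis k 1 $ a else A $ a $ j) / det A)"
    using cramer[OF assms] by blast
  then show ?thesis
    by (simp add: matrix_vector_mult_axis column_def vec_eq_iff)
qed

lemma eventually_invertible:
  fixes A :: "complex \<Rightarrow> complex^'n^'n"
  assumes "mat_analytic_on A {z}" "invertible (A z)"
  shows "eventually (\<lambda>s. invertible (A s)) (nhds z)"
proof -
  have "isCont (\<lambda>s. det (A s)) z"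
    using det_analytic_on[OF assms(1)] by (rule analytic_at_imp_isCont)
  then show ?thesis
    using assms(2) unfolding invertible_det_nz
    by (simp add: isCont_def tendsto_imp_eventually_ne eventually_nhds_conv_at)
qed

text \<open>The Cramer quotients are analytic at \<open>z\<close> and agree with the entries of the
  inverse on a neighbourhood, where \<open>A\<close> stays invertible.\<close>

lemma mat_analytic_inverse:
  fixes A :: "complex \<Rightarrow> complex^'n^'n"
  assumes "mat_analytic_on A {z}" "invertible (A z)"
  shows "mat_analytic_on (\<lambda>s. matrix_inv (A s)) {z}"
  unfolding mat_analytic_on_def
proof (intro allI)
  fix i k
  let ?N = "\<lambda>s. \<chi> a j. if j = i then axis k 1 $ a else A s $ a $ j"
  have "(\<lambda>s. ?N s $ a $ j) analytic_on {z}" for a j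
    using assms(1) by (cases "j = i") (simp_all add: mat_analytic_on_def)
  then have "mat_analytic_on ?N {z}"
    unfolding mat_analytic_on_def by blast
  then have "(\<lambda>s. det (?N s) / det (A s)) analytic_on {z}"
    using assms by (intro analytic_on_divide det_analytic_on) (auto simp: invertible_det_nz)
  moreover have ev: "eventually (\<lambda>s. det (?N s) / det (A s) = matrix_inv (A s) $ i $ k) (nhds z)"
    using eventually_invertible[OF assms]
    by (rule eventually_mono) (simp add: invertible_det_nz matrix_inv_entry)
  ultimately show "(\<lambda>s. matrix_inv (A s) $ i $ k) analytic_on {z}"
    unfolding analytic_at_cong[OF ev refl] by blast
qed

text \<open>Since the inverse is already known to be differentiable, its derivative follows by
  differentiating \<open>A s ** matrix_inv (A s) = mat 1\<close>, which holds near
  \<open>z\<close>.\<close>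

lemma has_mat_deriv_inverse:
  fixes A :: "complex \<Rightarrow> complex^'n^'n"
  assumes "mat_analytic_on A {z}" "invertible (A z)" "has_mat_deriv A D z"
  shows "has_mat_deriv (\<lambda>s. matrix_inv (A s)) (- (matrix_inv (A z) ** D ** matrix_inv (A z))) z"
proof -
  let ?X = "matrix_inv (A z)"
  define E where "E = mat_deriv (\<lambda>s. matrix_inv (A s)) z"
  have E: "has_mat_deriv (\<lambda>s. matrix_inv (A s)) E z"
    unfolding E_def using mat_analytic_inverse[OF assms(1,2)]
    by (rule mat_analytic_imp_has_mat_deriv) simp
  have "has_mat_deriv (\<lambda>s. A s ** matrix_inv (A s)) 0 z"
    using has_mat_deriv_cong_ev[of "\<lambda>s. A s ** matrix_inv (A s)" "\<lambda>s. mat 1" z 0]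
      eventually_mono[OF eventually_invertible[OF assms(1,2)] matrix_inv_mult(1)]
      has_mat_deriv_const by blast
  then have "D ** ?X + A z ** E = 0"
    using has_mat_deriv_unique has_mat_deriv_mult[OF assms(3) E] by blast
  then have "?X ** (D ** ?X + A z ** E) = 0"
    by simp
  then have "?X ** D ** ?X + E = 0"
    by (simp add: matrix_add_ldistrib matrix_mul_assoc matrix_inv_mult[OF assms(2)])
  then have "E = - (?X ** D ** ?X)"
    by (simp add: eq_neg_iff_add_eq_0 add.commute)
  then show ?thesis using E by simp
qed

lemma mat_analytic_on_mult:
  "mat_analytic_on A S \<Longrightarrow> mat_analytic_on B S \<Longrightarrow> mat_analytic_on (\<lambda>s. A s ** B s) S"
  unfolding mat_analytic_on_def matrix_matrix_mult_def by (auto intro!: analytic_intros)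

lemma mat_analytic_on_const: "mat_analytic_on (\<lambda>s. A) S"
  by (simp add: mat_analytic_on_def)

section \<open>Derivatives of the full and reduced transfer functions\<close>

lemma has_mat_deriv_transfer:
  assumes "mat_analytic_on K {z}" "invertible (K z)"
    and "has_mat_deriv K K' z" "has_mat_deriv B B' z" "has_mat_deriv C C' z"
  defines "X \<equiv> matrix_inv (K z)"
  shows "has_mat_deriv (transfer K B C)
    (C' ** X ** B z - C z ** X ** K' ** X ** B z + C z ** X ** B') z"
proof -
  have "has_mat_deriv (\<lambda>s. C s ** matrix_inv (K s) ** B s)
    ((C' ** X + C z ** (- (X ** K' ** X))) ** B z + C z ** X ** B') z"
    unfolding X_def
    by (intro has_mat_deriv_mult has_mat_deriv_inverse assms)
  then show ?thesis
    unfolding transfer_def[abs_def]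
    by (simp add: matrix_add_rdistrib matrix_diff_rdistrib matrix_mult_minus_right matrix_mult_minus_left matrix_mul_assoc)
qed

text \<open>The reduced model is a transfer function of reduced data; in its derivative each reduced
  inverse is enclosed by \<open>V\<close> and \<open>transpose W\<close>, forming
  \<open>G\<close>.\<close>

lemma (in petrov_galerkin) has_mat_deriv_reduced_transfer:
  assumes "mat_analytic_on Ks {z}" "Ks z = K"
    and "has_mat_deriv Ks K' z" "has_mat_deriv B B' z" "has_mat_deriv C C' z"
  shows "has_mat_deriv (reduced_transfer V W Ks B C)
    (C' ** G ** B z - C z ** G ** K' ** G ** B z + C z ** G ** B') z"
proof -
  have "mat_analytic_on (reduced_K V W Ks) {z}"
    unfolding reduced_K_def[abs_def]
    by (intro mat_analytic_on_mult mat_analytic_on_const assms)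
  moreover have "invertible (reduced_K V W Ks z)"
    using invertible_reduced assms(2) by (simp add: reduced_K_def)
  moreover have "has_mat_deriv (reduced_K V W Ks) (transpose W ** K' ** V) z"
    unfolding reduced_K_def[abs_def]
    by (intro has_mat_deriv_mult_const_right has_mat_deriv_mult_const_left assms)
  moreover have "has_mat_deriv (reduced_B W B) (transpose W ** B') z"
    unfolding reduced_B_def[abs_def] by (intro has_mat_deriv_mult_const_left assms)
  moreover have "has_mat_deriv (reduced_C V C) (C' ** V) z"
    unfolding reduced_C_def[abs_def] by (intro has_mat_deriv_mult_const_right assms)
  ultimately show ?thesis
    unfolding reduced_transfer_def
    by (rule has_mat_deriv_transfer[THEN back_subst[where P="\<lambda>D. has_mat_deriv _ D z"]])
      (simp add: G_def reduced_B_def reduced_C_def reduced_K_def assms(2) matrix_mul_assoc)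
qed

lemma (in petrov_galerkin) norm_derivative_error:
  fixes v w :: "complex^'n" and b :: "complex^'m" and c :: "complex^'p"
  assumes "v \<in> mat_ran V" "w \<in> mat_ran W"
    and an: "mat_analytic_on Ks {z}" and K: "Ks z = K"
    and B': "has_mat_deriv B B' z" and C': "has_mat_deriv C C' z"
  defines "\<alpha> \<equiv> norm (K *v v - B z *v b) / cos_P" and "\<beta> \<equiv> norm (w v* K - c v* C z) / cos_Q"
  shows "norm (scalar_product c (mat_deriv (transfer Ks B C) z *v b)
             - scalar_product c (mat_deriv (reduced_transfer V W Ks B C) z *v b))
    \<le> deriv_const Ks B C z b c * (\<alpha> + \<beta> + \<alpha> * \<beta>)"
proof -
  define K' where "K' = mat_deriv Ks z"
  define X where "X = matrix_inv K"
  define M where "M = deriv_const Ks B C z b c"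
  define p where "p = res_P (K *v v - B z *v b)"
  define u where "u = res_Q (w v* K - c v* C z)"
  \<comment> \<open>By the product rule, \<open>y'\<close> and \<open>x'\<close> are the derivatives
    of \<open>c\<^sup>T C K\<inverse>\<close> and \<open>K\<inverse> B b\<close>. They absorb the
    term in \<open>K'\<close>, unlike their namesakes in \<open>derivative_error\<close>, and are
    bounded by \<open>M\<close>.\<close>
  define y' where "y' = c v* (C' ** X + C z ** (- (X ** K' ** X)))"
  define x' where "x' = ((- (X ** K' ** X)) ** B z + X ** B') *v b"
  have inv: "invertible (Ks z)"
    using invertible_K K by simp
  have K': "has_mat_deriv Ks K' z"
    unfolding K'_def using an by (rule mat_analytic_imp_has_mat_deriv) simp
  have X': "has_mat_deriv (\<lambda>s. matrix_inv (Ks s)) (- (X ** K' ** X)) z"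
    using has_mat_deriv_inverse[OF an inv K'] by (simp add: K X_def)
  have M: "norm y' \<le> M" "norm x' \<le> M" "spectral_norm (- (X ** K' ** X)) \<le> M"
    using vec_deriv_vector_matrix[OF has_mat_deriv_mult[OF C' X'], of c]
      vec_deriv_matrix_vector[OF has_mat_deriv_mult[OF X' B'], of b]
      has_mat_deriv_imp_mat_deriv[OF X']
    by (simp_all add: M_def deriv_const_def y'_def x'_def K flip: X_def)
  have M0: "0 \<le> M"
    using M(1) norm_ge_zero order_trans by blast
  have p: "norm p \<le> \<alpha>" and u: "norm u \<le> \<beta>"
    unfolding p_def u_def \<alpha>_def \<beta>_def by (rule norm_res_P norm_res_Q)+
  have \<beta>0: "0 \<le> \<beta>"
    using u norm_ge_zero order_trans by blast
  have tri: "norm (- e - f - g) \<le> norm e + norm f + norm g" for e f g :: complex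
    using norm_triangle_ineq4[of "- e - f" g] norm_triangle_ineq4[of "- e" f] by simp
  have "scalar_product c (mat_deriv (transfer Ks B C) z *v b)
        - scalar_product c (mat_deriv (reduced_transfer V W Ks B C) z *v b)
      = - scalar_product y' p - scalar_product u x'
        - scalar_product u ((- (X ** K' ** X)) *v p)"
    using derivative_error[OF assms(1,2), of "c v* C'" "B z *v b" "c v* C z" K' "B' *v b"]
    unfolding has_mat_deriv_imp_mat_deriv[OF has_mat_deriv_transfer[OF an inv K' B' C']]
      has_mat_deriv_imp_mat_deriv[OF has_mat_deriv_reduced_transfer[OF an K K' B' C']]
      y'_def x'_def K
    by (simp add: X_def p_def u_def matrix_vector_mult_add_rdistrib matrix_vector_mult_diff_rdistrib
        vector_matrix_mult_add_rdistrib vector_matrix_mult_diff_rdistrib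
        matrix_mult_minus_left matrix_mult_minus_right matrix_vector_mult_minus_left
        scalar_product_add_right scalar_product_diff_right scalar_product_minus_right
        scalar_product_diff_left scalar_product_add_left
        scalar_product_matrix_vector flip: matrix_vector_mul_assoc vector_matrix_mul_assoc)
  then have "norm (scalar_product c (mat_deriv (transfer Ks B C) z *v b)
        - scalar_product c (mat_deriv (reduced_transfer V W Ks B C) z *v b))
      \<le> norm (scalar_product y' p) + norm (scalar_product u x')
        + norm (scalar_product u ((- (X ** K' ** X)) *v p))"
    using tri by simp
  also have "\<dots> \<le> norm y' * norm p + norm u * norm x'
        + norm u * (spectral_norm (- (X ** K' ** X)) * norm p)"
    by (intro add_mono norm_scalar_product_le
        order_trans[OF norm_scalar_product_le mult_left_mono[OF norm_matrix_vector_le]]) simp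
  also have "\<dots> \<le> M * \<alpha> + \<beta> * M + \<beta> * (M * \<alpha>)"
    by (intro add_mono mult_mono mult_nonneg_nonneg M p u M0 \<beta>0 norm_ge_zero spectral_norm_nonneg)
  finally show ?thesis
    by (simp add: M_def algebra_simps)
qed

section \<open>Transfer to the interpolation points\<close>

lemma columns_matrix_in_ran: "v j \<in> mat_ran (columns_matrix v)"
proof -
  have "columns_matrix v *v axis j 1 = v j"
    by (simp add: matrix_vector_mult_axis column_def columns_matrix_def vec_eq_iff)
  then show ?thesis
    unfolding mat_ran_def by (metis rangeI)
qed

theorem theorem3p1:
  fixes K :: "complex \<Rightarrow> complex^'n^'n"
    and B :: "complex \<Rightarrow> complex^'m^'n"
    and C :: "complex \<Rightarrow> complex^'n^'p"
    and \<sigma> \<mu> :: "'r::finite \<Rightarrow> complex"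
    and b :: "'r \<Rightarrow> complex^'m"
    and c :: "'r \<Rightarrow> complex^'p"
    and v w :: "'r \<Rightarrow> complex^'n"
    and V W :: "complex^'r^'n"
    and H Hr :: "complex \<Rightarrow> complex^'m^'p"
    and \<eta> \<xi> :: "'r \<Rightarrow> complex^'n"
  assumes analytic:
      "mat_analytic_on K (range \<sigma> \<union> range \<mu>)"
      "mat_analytic_on B (range \<sigma> \<union> range \<mu>)"
      "mat_analytic_on C (range \<sigma> \<union> range \<mu>)"
    and K_nonsingular: "\<And>s. s \<in> range \<sigma> \<union> range \<mu> \<Longrightarrow> invertible (K s)"
    and v_independent: "inj v" "vec.independent (range v)"
    and w_independent: "inj w" "vec.independent (range w)"
    and V: "V = columns_matrix v"
    and W: "W = columns_matrix w"
    and reduced_K_nonsingular: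
      "\<And>s. s \<in> range \<sigma> \<union> range \<mu> \<Longrightarrow> invertible (reduced_K V W K s)"
    and H: "H = transfer K B C"
    and Hr: "Hr = reduced_transfer V W K B C"
    and \<eta>: "\<And>j. \<eta> j = residual_B K B (\<sigma> j) (b j) (v j)"
    and \<xi>: "\<And>i. \<xi> i = residual_C K C (\<mu> i) (c i) (w i)"
  shows
    "(\<forall>j. norm (H (\<sigma> j) *v b j) \<noteq> 0 \<longrightarrow>
        norm (Hr (\<sigma> j) *v b j - H (\<sigma> j) *v b j) / norm (H (\<sigma> j) *v b j)
        \<le> cond_B K B C (\<sigma> j) (b j)
           * (sin (subspace_angle (space_C K C (\<sigma> j)) (space_W W))
              / cos (subspace_angle (space_P K V (\<sigma> j)) (space_W W)))
           * (norm (\<eta> j) / norm (B (\<sigma> j) *v b j)))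
     \<and> (\<forall>i. norm (c i v* H (\<mu> i)) \<noteq> 0 \<longrightarrow>
        norm (c i v* Hr (\<mu> i) - c i v* H (\<mu> i)) / norm (c i v* H (\<mu> i))
        \<le> cond_C K B C (\<mu> i) (c i)
           * (sin (subspace_angle (space_B K B (\<mu> i)) (space_V V))
              / cos (subspace_angle (space_Q K W (\<mu> i)) (space_V V)))
           * (norm (\<xi> i) / norm (c i v* C (\<mu> i))))
     \<and> (\<forall>i. \<mu> i = \<sigma> i \<longrightarrow>
        norm (scalar_product (c i) (Hr (\<mu> i) *v b i) - scalar_product (c i) (H (\<mu> i) *v b i))
        \<le> spectral_norm (matrix_inv (K (\<mu> i))) * norm (\<eta> i) * norm (\<xi> i)
           / max (cos (subspace_angle (space_P K V (\<mu> i)) (space_W W)))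
                 (cos (subspace_angle (space_Q K W (\<mu> i)) (space_V V)))
        \<and>
        norm (scalar_product (c i) (mat_deriv H (\<mu> i) *v b i)
              - scalar_product (c i) (mat_deriv Hr (\<mu> i) *v b i))
        \<le> deriv_const K B C (\<mu> i) (b i) (c i)
           * (norm (\<eta> i) / cos (subspace_angle (space_P K V (\<mu> i)) (space_W W))
              + norm (\<xi> i) / cos (subspace_angle (space_Q K W (\<mu> i)) (space_V V))
              + norm (\<eta> i) / cos (subspace_angle (space_P K V (\<mu> i)) (space_W W))
                * (norm (\<xi> i) / cos (subspace_angle (space_Q K W (\<mu> i)) (space_V V)))))"
proof -
  have vV: "v j \<in> mat_ran V" and wW: "w j \<in> mat_ran W" for j
    unfolding V W by (rule columns_matrix_in_ran)+
  have pg: "petrov_galerkin (K s) V W" if "s \<in> range \<sigma> \<union> range \<mu>" for s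
    using K_nonsingular[OF that] reduced_K_nonsingular[OF that]
    by (simp add: petrov_galerkin_def reduced_K_def)
  have H_eq: "H s = C s ** matrix_inv (K s) ** B s" for s
    by (simp add: H transfer_def)
  have Hr_eq: "Hr s = C s ** petrov_galerkin.G (K s) V W ** B s"
    if "s \<in> range \<sigma> \<union> range \<mu>" for s
    by (simp add: Hr reduced_transfer_def transfer_def reduced_K_def reduced_B_def reduced_C_def
        petrov_galerkin.G_def[OF pg[OF that]] matrix_mul_assoc)
  have eta: "\<eta> j = K (\<sigma> j) *v v j - B (\<sigma> j) *v b j" for j
    by (simp add: \<eta> residual_B_def)
  have xi: "\<xi> i = w i v* K (\<mu> i) - c i v* C (\<mu> i)" for i
    by (simp add: \<xi> residual_C_def)
  have sin: "sin (subspace_angle M (space_W W)) = subspace_gap M (space_W W)"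
    "sin (subspace_angle M (space_V V)) = subspace_gap M (space_V V)" for M
    by (rule subspace_angle; simp add: space_W_def space_V_def hermitian_comp_mat_ker
        subspace_0 subspace_orthogonal_comp subspace_mat_ran)+
  show ?thesis
  proof (intro conjI allI impI)
    fix j
    assume nz: "norm (H (\<sigma> j) *v b j) \<noteq> 0"
    \<comment> \<open>Nonvanishing lets the factor \<open>norm (B (\<sigma> j) *v b j)\<close> of
      \<open>cond_B\<close> cancel, leaving \<open>norm_error_right\<close> divided by the norm of
      \<open>H (\<sigma> j) *v b j\<close>.\<close>
    then have "B (\<sigma> j) *v b j \<noteq> 0"
      by (auto simp: H_eq simp flip: matrix_vector_mul_assoc)
    with nz show "norm (Hr (\<sigma> j) *v b j - H (\<sigma> j) *v b j) / norm (H (\<sigma> j) *v b j)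
        \<le> cond_B K B C (\<sigma> j) (b j)
           * (sin (subspace_angle (space_C K C (\<sigma> j)) (space_W W))
              / cos (subspace_angle (space_P K V (\<sigma> j)) (space_W W)))
           * (norm (\<eta> j) / norm (B (\<sigma> j) *v b j))"
      using divide_right_mono[OF petrov_galerkin.norm_error_right[OF pg[of "\<sigma> j"] vV[of j],
            where C="C (\<sigma> j)" and B="B (\<sigma> j)" and b="b j"], OF _ norm_ge_zero[of "H (\<sigma> j) *v b j"]]
      by (simp add: cond_B_def Hr_eq eta sin space_C_def space_P_def mult_ac flip: H H_eq)
  next
    fix i
    assume nz: "norm (c i v* H (\<mu> i)) \<noteq> 0"
    then have "c i v* C (\<mu> i) \<noteq> 0"
      by (auto simp: H_eq simp flip: vector_matrix_mul_assoc)
    with nz show "norm (c i v* Hr (\<mu> i) - c i v* H (\<mu> i)) / norm (c i v* H (\<mu> i))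
        \<le> cond_C K B C (\<mu> i) (c i)
           * (sin (subspace_angle (space_B K B (\<mu> i)) (space_V V))
              / cos (subspace_angle (space_Q K W (\<mu> i)) (space_V V)))
           * (norm (\<xi> i) / norm (c i v* C (\<mu> i)))"
      using divide_right_mono[OF petrov_galerkin.norm_error_left[OF pg[of "\<mu> i"] wW[of i],
            where C="C (\<mu> i)" and B="B (\<mu> i)" and c="c i"], OF _ norm_ge_zero[of "c i v* H (\<mu> i)"]]
      by (simp add: cond_C_def Hr_eq xi sin space_B_def space_Q_def mult_ac flip: H H_eq)
  next
    fix i
    assume "\<mu> i = \<sigma> i"
    \<comment> \<open>Coincidence of the points places both residuals at \<open>\<mu> i\<close>, so
      a single instance of the locale covers both two-sided estimates.\<close>
    then have eta': "\<eta> i = K (\<mu> i) *v v i - B (\<mu> i) *v b i"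
      using eta[of i] by simp
    show "norm (scalar_product (c i) (Hr (\<mu> i) *v b i) - scalar_product (c i) (H (\<mu> i) *v b i))
        \<le> spectral_norm (matrix_inv (K (\<mu> i))) * norm (\<eta> i) * norm (\<xi> i)
           / max (cos (subspace_angle (space_P K V (\<mu> i)) (space_W W)))
                 (cos (subspace_angle (space_Q K W (\<mu> i)) (space_V V)))"
      unfolding H_eq Hr_eq[OF UnI2[OF rangeI]] eta' xi space_P_def space_Q_def
      by (rule petrov_galerkin.norm_error_two_sided[OF pg vV wW]) simp
    have an: "mat_analytic_on K {\<mu> i}"
      using analytic(1) by (auto simp: mat_analytic_on_def intro: analytic_on_subset)
    show "norm (scalar_product (c i) (mat_deriv H (\<mu> i) *v b i)
              - scalar_product (c i) (mat_deriv Hr (\<mu> i) *v b i))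
        \<le> deriv_const K B C (\<mu> i) (b i) (c i)
           * (norm (\<eta> i) / cos (subspace_angle (space_P K V (\<mu> i)) (space_W W))
              + norm (\<xi> i) / cos (subspace_angle (space_Q K W (\<mu> i)) (space_V V))
              + norm (\<eta> i) / cos (subspace_angle (space_P K V (\<mu> i)) (space_W W))
                * (norm (\<xi> i) / cos (subspace_angle (space_Q K W (\<mu> i)) (space_V V))))"
      unfolding H Hr eta' xi space_P_def space_Q_def
      by (rule petrov_galerkin.norm_derivative_error[OF pg vV wW an refl
            mat_analytic_imp_has_mat_deriv[OF analytic(2)]
            mat_analytic_imp_has_mat_deriv[OF analytic(3)]]) simp_all
  qed
qed

end
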